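(* For every integer $n\geq 9$ with $n\equiv 2 \pmod 7$, there exists a simple plane graph $G$ on $n$ vertices containing neither $K_4$ nor $C_5$ as a subgraph such that $e(G)=\frac{15}{7}(n-2)$.
   Context: $K_4$ is the complete graph on $4$ vertices, $C_5$ the cycle on $5$ vertices; $e(G)$ is the number of edges of $G$. *)

theory Defs
  imports "HOL-Analysis.Analysis"
begin

definition simple_graph :: "'a set \<Rightarrow> 'a set set \<Rightarrow> bool" where
  "simple_graph V E \<longleftrightarrow> finite V \<and> (\<forall>e\<in>E. e \<subseteq> V \<and> card e = 2)"

definition plane_embedding ::
  "'a set \<Rightarrow> 'a set set \<Rightarrow> ('a \<Rightarrow> complex) \<Rightarrow> ('a set \<Rightarrow> real \<Rightarrow> complex) \<Rightarrow> bool" where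
  "plane_embedding V E p \<gamma> \<longleftrightarrow>
     inj_on p V \<and>
     (\<forall>e\<in>E. arc (\<gamma> e) \<and> {pathstart (\<gamma> e), pathfinish (\<gamma> e)} = p ` e \<and>
             path_image (\<gamma> e) \<inter> p ` V = p ` e) \<and>
     (\<forall>e\<in>E. \<forall>e'\<in>E. e \<noteq> e' \<longrightarrow> path_image (\<gamma> e) \<inter> path_image (\<gamma> e') \<subseteq> p ` (e \<inter> e'))"

definition planar_graph :: "'a set \<Rightarrow> 'a set set \<Rightarrow> bool" where
  "planar_graph V E \<longleftrightarrow> (\<exists>p \<gamma>. plane_embedding V E p \<gamma>)"

definition contains_K4 :: "'a set \<Rightarrow> 'a set set \<Rightarrow> bool" where
  "contains_K4 V E \<longleftrightarrow> (\<exists>S\<subseteq>V. card S = 4 \<and> (\<forall>x\<in>S. \<forall>y\<in>S. x \<noteq> y \<longrightarrow> {x, y} \<in> E))"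

definition contains_C5 :: "'a set \<Rightarrow> 'a set set \<Rightarrow> bool" where
  "contains_C5 V E \<longleftrightarrow> (\<exists>v :: nat \<Rightarrow> 'a. inj_on v {0..<5} \<and> v ` {0..<5} \<subseteq> V \<and>
      (\<forall>i<5. {v i, v ((i + 1) mod 5)} \<in> E))"

end

theory Submission
  imports Defs "HOL-Library.Nat_Bijection"
begin

text \<open>
  A diamond is \<open>K\<^sub>4\<close> minus an edge. Three diamonds joined in a ring at their vertices of degree
  two form a plane graph with 9 vertices and 15 edges whose outer face is a hexagon. Glue \<open>k\<close>
  copies of it at two opposite vertices of that hexagon: this gives \<open>7k + 2\<close> vertices and \<open>15k\<close>
  edges. The graph is bipartite once the diagonals of the diamonds are removed, so a triangle or
  a 5-cycle uses a diagonal. If \<open>x \<noteq> y\<close> are further neighbours of the two ends of a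
  diagonal, one of each, then \<open>x\<close> and \<open>y\<close> are non-adjacent and have no common neighbours except
  these ends, which excludes \<open>K\<^sub>4\<close> and \<open>C\<^sub>5\<close>.

  For planarity, the vertices are placed at lattice points on four vertical lines so that edges
  are segments that join vertical neighbours or consecutive lines in an order-preserving way.
\<close>

section \<open>Straight-line drawings with vertices on vertical lattice lines\<close>

definition edges_of :: "('a \<times> 'a) set \<Rightarrow> 'a set set" where
  "edges_of R = (\<lambda>(a, b). {a, b}) ` R"

lemma pair_in_edges_of: "{a, b} \<in> edges_of R \<longleftrightarrow> (a, b) \<in> R \<or> (b, a) \<in> R"
  by (auto simp: edges_of_def doubleton_eq_iff image_iff split: prod.splits)

definition lattice_point :: "nat \<times> nat \<Rightarrow> complex" where
  "lattice_point a = Complex (real (fst a)) (real (snd a))"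

text \<open>Steps are oriented upwards or to the right, so an edge has only one admissible ordered
  form. A step to the right may change the height by any amount.\<close>

definition lattice_step :: "nat \<times> nat \<Rightarrow> nat \<times> nat \<Rightarrow> bool" where
  "lattice_step a b \<longleftrightarrow> fst b = fst a \<and> snd b = Suc (snd a) \<or> fst b = Suc (fst a)"

lemma inj_lattice_point: "inj lattice_point"
  by (auto simp: inj_def lattice_point_def complex_eq_iff prod_eq_iff)

lemma in_lattice_segmentE:
  assumes "z \<in> closed_segment (lattice_point a) (lattice_point b)"
  obtains t where "0 \<le> t" "t \<le> 1"
    "Re z = real (fst a) + t * (real (fst b) - real (fst a))"
    "Im z = real (snd a) + t * (real (snd b) - real (snd a))"
proof -
  obtain t where t: "0 \<le> t" "t \<le> 1" "z = (1 - t) *\<^sub>R lattice_point a + t *\<^sub>R lattice_point b"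
    using assms by (auto simp: in_segment)
  show thesis
    by (rule that[OF t(1,2)]) (simp_all add: t(3) lattice_point_def algebra_simps)
qed

lemma unit_interval_between_naturals:
  fixes t :: real
  assumes "real m = real n + t" "0 \<le> t" "t \<le> 1"
  shows "t = 0 \<or> t = 1"
proof -
  have "n \<le> m" "m \<le> Suc n" using assms by linarith+
  then have "m = n \<or> m = Suc n" by linarith
  then show ?thesis using assms(1) by auto
qed

text \<open>Along a step some coordinate grows by exactly 1, so it is integral only at the two
  ends.\<close>

lemma lattice_point_on_step:
  assumes "lattice_step a b"
    and "lattice_point c \<in> closed_segment (lattice_point a) (lattice_point b)"
  shows "c = a \<or> c = b"
proof -
  obtain t where t: "0 \<le> t" "t \<le> 1"
    "real (fst c) = real (fst a) + t * (real (fst b) - real (fst a))"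
    "real (snd c) = real (snd a) + t * (real (snd b) - real (snd a))"
    using in_lattice_segmentE[OF assms(2)] by (auto simp: lattice_point_def)
  have "t = 0 \<or> t = 1"
  proof (cases "fst b = fst a")
    case True
    then have "snd b = Suc (snd a)" using assms(1) by (auto simp: lattice_step_def)
    then show ?thesis using t by (intro unit_interval_between_naturals[of "snd c" "snd a"]) auto
  next
    case False
    then have "fst b = Suc (fst a)" using assms(1) by (auto simp: lattice_step_def)
    then show ?thesis using t by (intro unit_interval_between_naturals[of "fst c" "fst a"]) auto
  qed
  then show ?thesis using t by (auto simp: prod_eq_iff)
qed

lemma step_point_with_integral_abscissa:
  assumes "fst b = Suc (fst a)"
    and z: "z \<in> closed_segment (lattice_point a) (lattice_point b)" and "Re z = real m"
  shows "z = lattice_point a \<or> z = lattice_point b"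
proof -
  obtain t where t: "0 \<le> t" "t \<le> 1" "Re z = real (fst a) + t"
    "Im z = real (snd a) + t * (real (snd b) - real (snd a))"
    using in_lattice_segmentE[OF z] assms(1) by auto
  then have "t = 0 \<or> t = 1"
    using assms(3) by (intro unit_interval_between_naturals[of m "fst a"]) auto
  then show ?thesis using t assms(1) by (auto simp: lattice_point_def complex_eq_iff)
qed

text \<open>The critical case is two rightward steps between the same lines. Their height difference
  is affine in the common parameter and, by \<open>mono\<close>, does not change sign. A zero
  strictly inside would make it vanish at both ends, so the two steps would coincide.\<close>

lemma lattice_steps_meet_in_lattice:
  assumes ab: "lattice_step a b" and cd: "lattice_step c d" and ne: "(a, b) \<noteq> (c, d)"
    and mono: "\<lbrakk>fst a = fst c; fst b = Suc (fst a); fst d = Suc (fst c)\<rbrakk>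
      \<Longrightarrow> snd a \<le> snd c \<and> snd b \<le> snd d \<or> snd c \<le> snd a \<and> snd d \<le> snd b"
    and z: "z \<in> closed_segment (lattice_point a) (lattice_point b)"
      "z \<in> closed_segment (lattice_point c) (lattice_point d)"
  shows "z \<in> range lattice_point"
proof -
  obtain t where t: "0 \<le> t" "t \<le> 1"
    "Re z = real (fst a) + t * (real (fst b) - real (fst a))"
    "Im z = real (snd a) + t * (real (snd b) - real (snd a))"
    using in_lattice_segmentE[OF z(1)] by blast
  obtain s where s: "0 \<le> s" "s \<le> 1"
    "Re z = real (fst c) + s * (real (fst d) - real (fst c))"
    "Im z = real (snd c) + s * (real (snd d) - real (snd c))"
    using in_lattice_segmentE[OF z(2)] by blast
  consider (vert) "fst b = fst a" "fst d = fst c" | (left) "fst b = Suc (fst a)" "fst d = fst c"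
    | (right) "fst b = fst a" "fst d = Suc (fst c)"
    | (span) "fst b = Suc (fst a)" "fst d = Suc (fst c)"
    using ab cd by (auto simp: lattice_step_def)
  then show ?thesis
  proof cases
    case vert
    then have bd: "snd b = Suc (snd a)" "snd d = Suc (snd c)" "fst a = fst c"
      using ab cd t(3) s(3) by (auto simp: lattice_step_def)
    with ne vert have "snd a \<noteq> snd c" by (auto simp: prod_eq_iff)
    moreover have "real (snd a) + t = real (snd c) + s" using bd t s by auto
    \<comment> \<open>The starting heights differ by a nonzero integer, while \<open>t - s\<close>
      lies between -1 and 1.\<close>
    ultimately have "t = 0 \<or> t = 1" using t(1,2) s(1,2) by linarith
    then have "z = lattice_point a \<or> z = lattice_point b"
      using t vert by (auto simp: lattice_point_def complex_eq_iff)
    then show ?thesis by auto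
  next
    case left
    then show ?thesis using step_point_with_integral_abscissa[OF left(1) z(1), of "fst c"] s by auto
  next
    case right
    then show ?thesis using step_point_with_integral_abscissa[OF right(2) z(2), of "fst a"] t by auto
  next
    case span
    show ?thesis
    proof (cases "t = 0 \<or> t = 1")
      case True
      then have "z = lattice_point a \<or> z = lattice_point b"
        using t by (auto simp: lattice_point_def complex_eq_iff)
      then show ?thesis by auto
    next
      case False
      then have t01: "0 < t" "t < 1" using t by auto
      have x: "real (fst a) + t = real (fst c) + s" using span t s by auto
      then have ac: "fst a = fst c" using t01 s(1,2) by linarith
      with x have ts: "s = t" by simp
      let ?p = "real (snd c) - real (snd a)" and ?q = "real (snd d) - real (snd b)"
      \<comment> \<open>The height difference at the meeting point, interpolated between its values
        \<open>?p\<close> and \<open>?q\<close> on the two lines.\<close>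
      have 0: "(1 - t) * ?p + t * ?q = 0" using t(4) s(4) ts by (simp add: algebra_simps)
      have "0 \<le> ?p \<and> 0 \<le> ?q \<or> ?p \<le> 0 \<and> ?q \<le> 0" using mono[OF ac span] by auto
      then have "?p = 0 \<and> ?q = 0"
      proof
        assume pq: "0 \<le> ?p \<and> 0 \<le> ?q"
        then have "0 \<le> (1 - t) * ?p" "0 \<le> t * ?q" using t01 by simp_all
        with 0 have "(1 - t) * ?p = 0" "t * ?q = 0" by linarith+
        then show ?thesis using t01 by simp
      next
        assume pq: "?p \<le> 0 \<and> ?q \<le> 0"
        then have "(1 - t) * ?p \<le> 0" "t * ?q \<le> 0" using t01 by (simp_all add: mult_nonneg_nonpos)
        with 0 have "(1 - t) * ?p = 0" "t * ?q = 0" by linarith+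
        then show ?thesis using t01 by simp
      qed
      then have False using ne ac span by (simp add: prod_eq_iff)
      then show ?thesis ..
    qed
  qed
qed

text \<open>Segments of two distinct edges can meet only in lattice points, and a step contains no
  lattice points but its ends; so a meeting point is a common end.\<close>

lemma planar_layered:
  assumes RV: "R \<subseteq> V \<times> V" and step: "\<And>a b. (a, b) \<in> R \<Longrightarrow> lattice_step a b"
    and mono: "\<And>a b c d. \<lbrakk>(a, b) \<in> R; (c, d) \<in> R; fst a = fst c; fst b = Suc (fst a);
      fst d = Suc (fst c)\<rbrakk>
      \<Longrightarrow> snd a \<le> snd c \<and> snd b \<le> snd d \<or> snd c \<le> snd a \<and> snd d \<le> snd b"
  shows "planar_graph V (edges_of R)"
proof -
  \<comment> \<open>An edge is an unordered set, so the direction of its segment is recovered by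
    choosing a pair of \<open>R\<close> that represents it.\<close>
  define \<gamma> where "\<gamma> e = (let (a, b) = (SOME (a, b). (a, b) \<in> R \<and> e = {a, b})
      in linepath (lattice_point a) (lattice_point b))" for e
  have \<gamma>: "\<exists>a b. (a, b) \<in> R \<and> e = {a, b} \<and> \<gamma> e = linepath (lattice_point a) (lattice_point b)"
    if "e \<in> edges_of R" for e
  proof -
    have "\<exists>q. case q of (a, b) \<Rightarrow> (a, b) \<in> R \<and> e = {a, b}"
      using that by (auto simp: edges_of_def)
    then have "case (SOME (a, b). (a, b) \<in> R \<and> e = {a, b}) of (a, b) \<Rightarrow> (a, b) \<in> R \<and> e = {a, b}"
      by (rule someI_ex)
    then show ?thesis unfolding \<gamma>_def by (auto split: prod.splits)
  qed
  have "arc (\<gamma> e) \<and> {pathstart (\<gamma> e), pathfinish (\<gamma> e)} = lattice_point ` e \<and>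
      path_image (\<gamma> e) \<inter> lattice_point ` V = lattice_point ` e" if e: "e \<in> edges_of R" for e
  proof -
    obtain a b where ab: "(a, b) \<in> R" "e = {a, b}"
      and g: "\<gamma> e = linepath (lattice_point a) (lattice_point b)"
      using \<gamma>[OF e] by blast
    have "a \<noteq> b" using step[OF ab(1)] by (auto simp: lattice_step_def)
    then have "lattice_point a \<noteq> lattice_point b" using inj_lattice_point by (simp add: inj_eq)
    moreover have "a \<in> V" "b \<in> V" using RV ab by auto
    ultimately show ?thesis
      unfolding g using lattice_point_on_step[OF step[OF ab(1)]]
      by (auto simp: ab(2) arc_linepath image_iff)
  qed
  moreover have "path_image (\<gamma> e) \<inter> path_image (\<gamma> e') \<subseteq> lattice_point ` (e \<inter> e')"
    if e: "e \<in> edges_of R" "e' \<in> edges_of R" "e \<noteq> e'" for e e'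
  proof
    fix z assume z: "z \<in> path_image (\<gamma> e) \<inter> path_image (\<gamma> e')"
    obtain a b where ab: "(a, b) \<in> R" "e = {a, b}"
      and g: "\<gamma> e = linepath (lattice_point a) (lattice_point b)"
      using \<gamma>[OF e(1)] by blast
    obtain c d where cd: "(c, d) \<in> R" "e' = {c, d}"
      and g': "\<gamma> e' = linepath (lattice_point c) (lattice_point d)"
      using \<gamma>[OF e(2)] by blast
    have z': "z \<in> closed_segment (lattice_point a) (lattice_point b)"
      "z \<in> closed_segment (lattice_point c) (lattice_point d)"
      using z g g' by auto
    have "z \<in> range lattice_point"
      using lattice_steps_meet_in_lattice[OF step[OF ab(1)] step[OF cd(1)] _ _ z']
        mono[OF ab(1) cd(1)] e(3) ab(2) cd(2) by blast
    then obtain w where w: "z = lattice_point w" by blast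
    have "w \<in> e \<inter> e'"
      using lattice_point_on_step[OF step[OF ab(1)]] lattice_point_on_step[OF step[OF cd(1)]]
        z' w ab(2) cd(2) by auto
    then show "z \<in> lattice_point ` (e \<inter> e')" using w by blast
  qed
  ultimately have "plane_embedding V (edges_of R) lattice_point \<gamma>"
    using inj_lattice_point by (auto simp: plane_embedding_def intro: inj_on_subset)
  then show ?thesis by (auto simp: planar_graph_def)
qed

section \<open>Renaming vertices along an injection\<close>

lemma simple_graph_image:
  assumes "inj f" "simple_graph V E"
  shows "simple_graph (f ` V) ((`) f ` E)"
  using assms by (auto simp: simple_graph_def card_image inj_on_subset)

text \<open>The drawing is kept: new vertices and edges are drawn where their preimages under
  \<open>f\<close> were.\<close>

lemma planar_graph_image:
  assumes f: "inj f" and "planar_graph V E"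
  shows "planar_graph (f ` V) ((`) f ` E)"
proof -
  obtain p \<gamma> where pe: "plane_embedding V E p \<gamma>" using assms(2) by (auto simp: planar_graph_def)
  have inv: "inv f ` f ` A = A" for A using f by (simp add: image_image)
  have inv': "(\<lambda>x. p (inv f x)) ` f ` A = p ` A" for A using f by (simp add: image_image)
  have "plane_embedding (f ` V) ((`) f ` E) (\<lambda>x. p (inv f x)) (\<lambda>e. \<gamma> (inv f ` e))"
    unfolding plane_embedding_def
  proof (intro conjI ballI impI)
    show "inj_on (\<lambda>x. p (inv f x)) (f ` V)"
      using pe f by (auto simp: plane_embedding_def inj_on_def)
  next
    fix e e' assume "e \<in> (`) f ` E" "e' \<in> (`) f ` E" "e \<noteq> e'"
    then obtain d d' where d: "d \<in> E" "d' \<in> E" "d \<noteq> d'" "e = f ` d" "e' = f ` d'" by blast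
    have "e \<inter> e' = f ` (d \<inter> d')" using d f by (simp add: image_Int)
    then show "path_image (\<gamma> (inv f ` e)) \<inter> path_image (\<gamma> (inv f ` e'))
        \<subseteq> (\<lambda>x. p (inv f x)) ` (e \<inter> e')"
      using pe d by (simp add: inv inv' plane_embedding_def del: image_Int)
  next
    fix e assume "e \<in> (`) f ` E"
    then obtain d where d: "d \<in> E" "e = f ` d" by blast
    show "arc (\<gamma> (inv f ` e))"
      "{pathstart (\<gamma> (inv f ` e)), pathfinish (\<gamma> (inv f ` e))} = (\<lambda>x. p (inv f x)) ` e"
      "path_image (\<gamma> (inv f ` e)) \<inter> (\<lambda>x. p (inv f x)) ` f ` V = (\<lambda>x. p (inv f x)) ` e"
      using pe d(1) unfolding d(2) inv inv' plane_embedding_def by blast+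
  qed
  then show ?thesis by (auto simp: planar_graph_def)
qed

lemma contains_K4_image:
  assumes f: "inj f" and "contains_K4 (f ` V) ((`) f ` E)"
  shows "contains_K4 V E"
proof -
  obtain S where S: "S \<subseteq> f ` V" "card S = 4"
    "\<And>x y. \<lbrakk>x \<in> S; y \<in> S; x \<noteq> y\<rbrakk> \<Longrightarrow> {x, y} \<in> (`) f ` E"
    using assms(2) by (auto simp: contains_K4_def)
  obtain T where T: "T \<subseteq> V" "S = f ` T" using S(1) by (auto simp: subset_image_iff)
  have "card T = 4" using S(2) T f by (simp add: card_image inj_on_subset)
  moreover have "{x, y} \<in> E" if "x \<in> T" "y \<in> T" "x \<noteq> y" for x y
  proof -
    have "f ` {x, y} \<in> (`) f ` E" using S(3)[of "f x" "f y"] that T f by (auto simp: inj_eq)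
    then show ?thesis using f by (auto simp: image_iff inj_image_eq_iff simp del: image_insert)
  qed
  ultimately show ?thesis using T by (auto simp: contains_K4_def)
qed

lemma contains_C5_image:
  assumes f: "inj f" and "contains_C5 (f ` V) ((`) f ` E)"
  shows "contains_C5 V E"
proof -
  obtain v where v: "inj_on v {0..<5::nat}" "v ` {0..<5} \<subseteq> f ` V"
    "\<And>i. i < 5 \<Longrightarrow> {v i, v ((i + 1) mod 5)} \<in> (`) f ` E"
    using assms(2) unfolding contains_C5_def by blast
  define w where "w i = inv f (v i)" for i
  have w: "f (w i) = v i \<and> w i \<in> V" if "i < 5" for i
  proof -
    have "v i \<in> f ` V" using v(2) that by auto
    then show ?thesis using f by (auto simp: w_def)
  qed
  have "inj_on w {0..<5}"
    using v(1) w unfolding inj_on_def by (metis atLeastLessThan_iff)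
  moreover have "{w i, w ((i + 1) mod 5)} \<in> E" if "i < 5" for i
  proof -
    have "f ` {w i, w ((i + 1) mod 5)} \<in> (`) f ` E" using v(3)[OF that] w that by simp
    then show ?thesis using f by (auto simp: image_iff inj_image_eq_iff simp del: image_insert)
  qed
  moreover have "w ` {0..<5} \<subseteq> V" using w by auto
  ultimately show ?thesis unfolding contains_C5_def by blast
qed

section \<open>The glued diamond rings and their planarity\<close>

text \<open>
  Vertices are pairs (line, height). The vertices shared by all copies are \<open>(0, 0)\<close> and \<open>(3, 0)\<close>;
  copy \<open>j\<close> occupies the heights \<open>4j, \<dots>, 4j + 3\<close> on line 1 and \<open>4j, 4j + 1, 4j + 2\<close> on line 2.
  Its diamonds are \<open>(0, 0), (1, h), (1, h + 1), (2, h)\<close> for \<open>h = 4j\<close> and \<open>h = 4j + 2\<close>, and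
  \<open>(2, 4j), (2, 4j + 1), (2, 4j + 2), (3, 0)\<close>.
\<close>

definition links :: "nat \<Rightarrow> ((nat \<times> nat) \<times> (nat \<times> nat)) set" where
  "links k =
    (\<lambda>h. ((0, 0), (1, h))) ` {..<4 * k} \<union>
    (\<lambda>h. ((1, h), (1, Suc h))) ` {h. h < 4 * k \<and> even h} \<union>
    (\<lambda>h. ((1, h), (2, 2 * (h div 2)))) ` {..<4 * k} \<union>
    (\<lambda>h. ((2, h), (2, Suc h))) ` {h. h < 4 * k \<and> h mod 4 < 2} \<union>
    (\<lambda>h. ((2, h), (3, 0))) ` {h. h < 4 * k \<and> h mod 4 < 3}"

definition nodes :: "nat \<Rightarrow> (nat \<times> nat) set" where
  "nodes k = {(0, 0), (3, 0)} \<union> {1} \<times> {..<4 * k} \<union> {2} \<times> {h. h < 4 * k \<and> h mod 4 < 3}"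

lemma links_iff: "((l, h), (m, i)) \<in> links k \<longleftrightarrow>
    l = 0 \<and> h = 0 \<and> m = 1 \<and> i < 4 * k \<or>
    l = 1 \<and> m = 1 \<and> i = Suc h \<and> h < 4 * k \<and> even h \<or>
    l = 1 \<and> m = 2 \<and> i = 2 * (h div 2) \<and> h < 4 * k \<or>
    l = 2 \<and> m = 2 \<and> i = Suc h \<and> h < 4 * k \<and> h mod 4 < 2 \<or>
    l = 2 \<and> m = 3 \<and> i = 0 \<and> h < 4 * k \<and> h mod 4 < 3"
  by (auto simp: links_def)

lemma links_subset_nodes: "links k \<subseteq> nodes k \<times> nodes k"
proof -
  have 1: "(1, Suc h) \<in> nodes k" if "h < 4 * k" "even h" for h
    using that unfolding nodes_def by simp presburger
  have 2: "(2, Suc h) \<in> nodes k" if "h < 4 * k" "h mod 4 < 2" for h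
  proof -
    have "Suc h < 4 * k" "Suc h mod 4 < 3" using that by presburger+
    then show ?thesis by (simp add: nodes_def)
  qed
  have 3: "(2, 2 * (h div 2)) \<in> nodes k" if "h < 4 * k" for h
  proof -
    have "2 * (h div 2) < 4 * k" "2 * (h div 2) mod 4 < 3" using that by presburger+
    then show ?thesis by (simp add: nodes_def)
  qed
  have 4: "(0, 0) \<in> nodes k" "(3, 0) \<in> nodes k" "h < 4 * k \<Longrightarrow> (1, h) \<in> nodes k"
    "h < 4 * k \<Longrightarrow> h mod 4 < 3 \<Longrightarrow> (2, h) \<in> nodes k" for h
    by (simp_all add: nodes_def)
  show ?thesis unfolding links_def by (intro Un_least image_subsetI SigmaI)
      (auto intro: 1 2 3 4 simp del: One_nat_def)
qed

lemma lattice_step_links: "(a, b) \<in> links k \<Longrightarrow> lattice_step a b"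
  by (auto simp: lattice_step_def links_def)

lemma planar_links: "planar_graph (nodes k) (edges_of (links k))"
proof (rule planar_layered[OF links_subset_nodes lattice_step_links])
  fix a b c d assume "(a, b) \<in> links k" "(c, d) \<in> links k" "fst a = fst c" "fst b = Suc (fst a)"
    "fst d = Suc (fst c)"
  then show "snd a \<le> snd c \<and> snd b \<le> snd d \<or> snd c \<le> snd a \<and> snd d \<le> snd b"
    by (cases a; cases b; cases c; cases d) (auto simp: links_iff intro: div_le_mono)
qed

section \<open>Counting vertices and edges\<close>

lemma card_residues:
  assumes "m \<le> 4"
  shows "card {h. h < 4 * k \<and> h mod 4 < m} = m * k" "finite {h. h < 4 * k \<and> h mod 4 < (m::nat)}"
proof -
  have "bij_betw (\<lambda>(j, r). 4 * j + r) ({..<k} \<times> {..<m}) {h. h < 4 * k \<and> h mod 4 < m}"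
    using assms
    by (intro bij_betwI[where g = "\<lambda>h. (h div 4, h mod 4)"]) auto
  then show "card {h. h < 4 * k \<and> h mod 4 < m} = m * k"
    by (auto dest!: bij_betw_same_card simp: mult.commute)
qed simp

lemma card_evens: "card {h. h < 4 * k \<and> even (h::nat)} = 2 * k"
proof -
  have "{h. h < 4 * k \<and> even h} = (*) 2 ` {..<2 * k}" by (auto elim!: evenE)
  then show ?thesis by (simp add: card_image inj_on_def)
qed

lemma card_nodes: "finite (nodes k)" "card (nodes k) = 7 * k + 2"
proof -
  let ?A = "{h. h < 4 * k \<and> h mod 4 < 3}"
  show "finite (nodes k)" by (simp add: nodes_def)
  have "card (nodes k) = card {(0::nat, 0::nat), (3, 0)} + card ({1::nat} \<times> {..<4 * k}) + card ({2::nat} \<times> ?A)"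
    unfolding nodes_def by (subst card_Un_disjoint; auto)+
  then show "card (nodes k) = 7 * k + 2"
    using card_residues(1)[of 3 k] by (simp add: card_cartesian_product)
qed

lemma card_edges_of_links: "card (edges_of (links k)) = 15 * k"
proof -
  let ?A = "(\<lambda>h. ((0, 0), (1, h))) ` {..<4 * k} :: ((nat \<times> nat) \<times> (nat \<times> nat)) set"
  let ?B = "(\<lambda>h. ((1, h), (1, Suc h))) ` {h. h < 4 * k \<and> even h} :: ((nat \<times> nat) \<times> (nat \<times> nat)) set"
  let ?C = "(\<lambda>h. ((1, h), (2, 2 * (h div 2)))) ` {..<4 * k} :: ((nat \<times> nat) \<times> (nat \<times> nat)) set"
  let ?D = "(\<lambda>h. ((2, h), (2, Suc h))) ` {h. h < 4 * k \<and> h mod 4 < 2} :: ((nat \<times> nat) \<times> (nat \<times> nat)) set"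
  let ?F = "(\<lambda>h. ((2, h), (3, 0))) ` {h. h < 4 * k \<and> h mod 4 < 3} :: ((nat \<times> nat) \<times> (nat \<times> nat)) set"
  have "card (links k) = card ?A + card ?B + card ?C + card ?D + card ?F"
    unfolding links_def by (subst card_Un_disjoint; auto)+
  \<comment> \<open>The five families contribute \<open>4 * k\<close>, \<open>2 * k\<close>,
    \<open>4 * k\<close>, \<open>2 * k\<close> and \<open>3 * k\<close>.\<close>
  also have "\<dots> = 15 * k"
    by (simp add: card_image inj_on_def card_evens card_residues)
  finally have "card (links k) = 15 * k" .
  \<comment> \<open>The reverse of a lattice step is never a lattice step, so no edge is counted in
    both directions.\<close>
  moreover have "inj_on (\<lambda>(a, b). {a, b}) (links k)"
    by (auto simp: inj_on_def doubleton_eq_iff dest!: lattice_step_links)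
      (auto simp: lattice_step_def)
  ultimately show ?thesis by (simp add: edges_of_def card_image)
qed

lemma simple_graph_links: "simple_graph (nodes k) (edges_of (links k))"
proof -
  have "a \<noteq> b" if "(a, b) \<in> links k" for a b
    using lattice_step_links[OF that] by (auto simp: lattice_step_def)
  then show ?thesis
    using links_subset_nodes[of k] card_nodes(1)[of k]
    by (auto simp: simple_graph_def edges_of_def card_insert_if)
qed

section \<open>Diagonals and the exclusion of K_4 and C_5\<close>

definition adj :: "nat \<Rightarrow> nat \<times> nat \<Rightarrow> nat \<times> nat \<Rightarrow> bool" where
  "adj k a b \<longleftrightarrow> (a, b) \<in> links k \<or> (b, a) \<in> links k"

text \<open>The edges with both ends of the same colour are the diagonals of the diamonds.\<close>

definition colour :: "nat \<times> nat \<Rightarrow> bool" where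
  "colour a = odd (if fst a = 2 then snd a else fst a)"

lemma adj_sym: "adj k a b \<Longrightarrow> adj k b a"
  by (auto simp: adj_def)

lemma common_neighbours_across_oriented_diagonal:
  assumes ab: "(a, b) \<in> links k" "colour a = colour b" and x: "adj k x a" "x \<noteq> b"
    and y: "adj k b y" "y \<noteq> a" and xy: "x \<noteq> y"
  shows "\<not> adj k x y \<and> (adj k x z \<longrightarrow> adj k z y \<longrightarrow> z = a \<or> z = b)"
proof -
  obtain zl zi where z: "z = (zl, zi)" by (cases z)
  consider (one) h where "a = (1, h)" "b = (1, Suc h)" "even h"
    | (two) h where "a = (2, h)" "b = (3, 0)" "h mod 4 = 1"
  proof -
    have "(\<exists>h. a = (1, h) \<and> b = (1, Suc h) \<and> even h) \<or>
        (\<exists>h. a = (2, h) \<and> b = (3, 0) \<and> odd h \<and> h mod 4 < 3)"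
      using ab by (cases a; cases b) (auto simp: links_iff colour_def)
    moreover have "odd h \<Longrightarrow> h mod 4 < 3 \<Longrightarrow> h mod 4 = 1" for h :: nat by presburger
    ultimately show thesis using that by blast
  qed
  then show ?thesis
  proof cases
    case one
    \<comment> \<open>Both ends of this diagonal have the same two further neighbours, so
      \<open>x\<close> and \<open>y\<close> are these two in some order.\<close>
    have x': "x = (0, 0) \<or> x = (2, h)"
      using x one by (cases x) (auto simp: adj_def links_iff)
    have y': "y = (0, 0) \<or> y = (2, h)"
      using y one by (cases y) (auto simp: adj_def links_iff)
    have i: "i = h \<or> i = Suc h" if "h = 2 * (i div 2)" for i
      using that by linarith
    show ?thesis using x' y' xy one by (auto simp: z adj_def links_iff dest: i)
  next
    case two
    have odd_h: "h \<noteq> 2 * (i div 2)" for i using two(3) by presburger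
    obtain m where x': "x = (2, m)" "m mod 4 \<noteq> 1" "m mod 4 \<noteq> 3" "m = Suc h \<or> h = Suc m"
    proof -
      have "x = (2, Suc h) \<or> (\<exists>m. h = Suc m \<and> x = (2, m))"
        using x two odd_h by (cases x) (auto simp: adj_def links_iff)
      moreover have "Suc h mod 4 = 2" using two(3) by presburger
      moreover have "m mod 4 = 0" if "h = Suc m" for m using two(3) that by presburger
      ultimately show thesis using that by auto
    qed
    obtain g where y': "y = (2, g)" "g mod 4 < 3" "g \<noteq> h" "g \<noteq> m"
      using y xy x' two by (cases y) (auto simp: adj_def links_iff)
    have mg: "g \<noteq> Suc m \<or> \<not> m mod 4 < 2" "m \<noteq> Suc g \<or> \<not> g mod 4 < 2"
    proof -
      show "g \<noteq> Suc m \<or> \<not> m mod 4 < 2" using x'(4) y'(3) two(3) by presburger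
      have "g mod 4 = 3" if "h = Suc (Suc g)" using that two(3) by presburger
      then show "m \<noteq> Suc g \<or> \<not> g mod 4 < 2" using x'(4) y'(2,3) by auto
    qed
    have "\<not> adj k x y" using x' y' mg by (auto simp: adj_def links_iff)
    moreover have "z = a \<or> z = b" if "adj k x z" "adj k z y"
    proof -
      have "zl = 1 \<or> zl = 3 \<and> zi = 0 \<or> zl = 2 \<and> (zi = Suc m \<and> m mod 4 < 2 \<or> m = Suc zi \<and> zi mod 4 < 2)"
        using that(1) x' by (auto simp: z adj_def links_iff)
      moreover have "zl \<noteq> 1"
        using that x' y' by (auto simp: z adj_def links_iff)
      moreover have "zi = h" if "zi = Suc m \<and> m mod 4 < 2 \<or> m = Suc zi \<and> zi mod 4 < 2"
      proof -
        have "m \<noteq> Suc h \<or> \<not> m mod 4 < 2" using two(3) by presburger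
        moreover have "h \<noteq> Suc (Suc zi) \<or> \<not> zi mod 4 < 2" using two(3) by presburger
        ultimately show ?thesis using that x'(4) by auto
      qed
      ultimately show ?thesis using two by (auto simp: z)
    qed
    ultimately show ?thesis by blast
  qed
qed

lemma common_neighbours_across_diagonal:
  assumes "adj k a b" "colour a = colour b" "adj k x a" "x \<noteq> b" "adj k b y" "y \<noteq> a" "x \<noteq> y"
  shows "\<not> adj k x y" "adj k x z \<Longrightarrow> adj k z y \<Longrightarrow> z = a \<or> z = b"
proof -
  have "\<not> adj k x y \<and> (adj k x z \<longrightarrow> adj k z y \<longrightarrow> z = a \<or> z = b)" for z
  proof (cases "(a, b) \<in> links k")
    case True
    then show ?thesis using common_neighbours_across_oriented_diagonal assms by blast
  next
    case False
    then have "(b, a) \<in> links k" using assms(1) by (simp add: adj_def)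
    then have "\<not> adj k y x \<and> (adj k y z \<longrightarrow> adj k z x \<longrightarrow> z = b \<or> z = a)"
      using common_neighbours_across_oriented_diagonal[of b a k y x z] assms adj_sym by metis
    then show ?thesis using adj_sym by blast
  qed
  then show "\<not> adj k x y" "adj k x z \<Longrightarrow> adj k z y \<Longrightarrow> z = a \<or> z = b" by blast+
qed

lemma no_K4: "\<not> contains_K4 (nodes k) (edges_of (links k))"
proof
  assume "contains_K4 (nodes k) (edges_of (links k))"
  then obtain S where S: "card S = 4" and adj: "\<And>x y. \<lbrakk>x \<in> S; y \<in> S; x \<noteq> y\<rbrakk> \<Longrightarrow> adj k x y"
    by (auto simp: contains_K4_def pair_in_edges_of adj_def)
  \<comment> \<open>Two vertices of equal colour in \<open>S\<close> would span a diagonal, and the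
    other two would be adjacent further neighbours of its ends. Hence \<open>colour\<close> is
    injective on four vertices, with only two values.\<close>
  have *: False if "a \<in> S" "b \<in> S" "a \<noteq> b" "colour a = colour b" for a b
  proof -
    have "card (S - {a, b}) = 2" using S that by (simp add: card_Diff_subset)
    then obtain x y where "S - {a, b} = {x, y}" "x \<noteq> y" by (auto simp: card_2_iff)
    then have "x \<in> S" "y \<in> S" "x \<notin> {a, b}" "y \<notin> {a, b}" by blast+
    then show False
      using common_neighbours_across_diagonal(1)[of k a b x y] adj that \<open>x \<noteq> y\<close>
      by (metis insertCI)
  qed
  then have "inj_on colour S" by (auto simp: inj_on_def)
  then have "card S \<le> card (UNIV :: bool set)" by (intro card_inj_on_le) auto
  then show False using S by simp
qed

lemma no_C5: "\<not> contains_C5 (nodes k) (edges_of (links k))"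
proof
  assume "contains_C5 (nodes k) (edges_of (links k))"
  then obtain v where inj: "inj_on v {0..<5::nat}"
    and adj: "\<And>i. i < 5 \<Longrightarrow> adj k (v i) (v ((i + 1) mod 5))"
    by (auto simp: contains_C5_def pair_in_edges_of adj_def)
  \<comment> \<open>Rotate the cycle so that the diagonal is \<open>w 0\<close>, \<open>w 1\<close>.
    Then \<open>w 4\<close> and \<open>w 2\<close> are the further neighbours of its ends, and
    \<open>w 3\<close> is a forbidden common neighbour of them.\<close>
  have *: "colour (v i) \<noteq> colour (v ((i + 1) mod 5))" if i: "i < 5" for i
  proof
    assume col: "colour (v i) = colour (v ((i + 1) mod 5))"
    define w where "w p = v ((i + p) mod 5)" for p
    have ne: "w p \<noteq> w q" if pq: "p < 5" "q < 5" "p \<noteq> q" for p q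
    proof -
      have "(i + r) mod 5 = (if i + r < 5 then i + r else i + r - 5)" if "r < 5" for r
        using i that by (simp add: le_mod_geq)
      then have "(i + p) mod 5 \<noteq> (i + q) mod 5" using i pq by (simp split: if_splits) linarith
      then show ?thesis using inj by (simp add: w_def inj_on_eq_iff)
    qed
    have w: "adj k (w p) (w (p + 1))" for p
      using adj[of "(i + p) mod 5"] by (simp add: w_def mod_simps)
    have w0: "w 0 = v i" "w 1 = v ((i + 1) mod 5)" "w 5 = w 0" using i by (simp_all add: w_def)
    have "w 3 = w 0 \<or> w 3 = w 1"
    proof (rule common_neighbours_across_diagonal(2))
      show "adj k (w 0) (w 1)" "adj k (w 1) (w 2)" "adj k (w 4) (w 0)"
        "adj k (w 4) (w 3)" "adj k (w 3) (w 2)"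
        using w[of 0] w[of 1] w[of 2] w[of 3] w[of 4] w0(3)
        by (simp_all add: adj_sym eval_nat_numeral)
      show "colour (w 0) = colour (w 1)" using col w0 by simp
    qed (rule ne; simp)+
    then show False using ne[of 3 0] ne[of 3 1] by simp
  qed
  \<comment> \<open>Two colours cannot alternate around a cycle of odd length.\<close>
  show False using *[of 0] *[of 1] *[of 2] *[of 3] *[of 4] by (simp add: numeral_2_eq_2)
qed

section \<open>Choosing the number of copies and passing to natural numbers as vertices\<close>

theorem theorem2:
  fixes n :: nat
  assumes "n \<ge> 9" and "n mod 7 = 2"
  shows "\<exists>(V :: nat set) (E :: nat set set).
           simple_graph V E \<and> planar_graph V E \<and> card V = n \<and>
           \<not> contains_K4 V E \<and> \<not> contains_C5 V E \<and>
           real (card E) = 15 / 7 * (real n - 2)"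
proof -
  define k where "k = n div 7"
  have n: "n = 7 * k + 2" using assms(2) unfolding k_def by presburger
  \<comment> \<open>The pairing bijection turns lattice coordinates into the required vertices of
    type \<open>nat\<close>.\<close>
  let ?V = "prod_encode ` nodes k" and ?E = "(`) prod_encode ` edges_of (links k)"
  have f: "inj prod_encode" by (rule inj_prod_encode)
  have "card ?V = n"
    using card_nodes(2)[of k] n by (simp add: card_image inj_prod_encode)
  moreover have "card ?E = 15 * k"
    using card_edges_of_links[of k] f
    by (simp add: card_image inj_on_def inj_image_eq_iff)
  then have "real (card ?E) = 15 / 7 * (real n - 2)" using n by simp
  ultimately show ?thesis
    using simple_graph_image[OF f simple_graph_links[of k]] planar_graph_image[OF f planar_links[of k]]
      contains_K4_image[OF f, of "nodes k"] contains_C5_image[OF f, of "nodes k"] no_K4[of k] no_C5[of k]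
    by blast
qed

end
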